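(* Let $(\mathcal{X},\wp)$ be a partial metric space, let $\mathcal{D}$ be a non-empty set, and for each $n\in\mathbb{N}$ let $f_n:\mathcal{D}\to\mathcal{X}$ be a function. If the sequence $\{f_n\}_{n\in\mathbb{N}}$ is uniformly convergent on $\mathcal{D}$ (to some function $f:\mathcal{D}\to\mathcal{X}$), then it is uniformly Cauchy on $\mathcal{D}$.
   Context: A partial metric on a non-empty set $\mathcal{X}$ is a map $\wp:\mathcal{X}\times\mathcal{X}\to\mathbb{R}$ such that for all $x,y,z\in\mathcal{X}$: (1) $x=y$ if and only if $\wp(x,x)=\wp(x,y)=\wp(y,y)$; (2) $0\le \wp(x,x)\le\wp(x,y)$; (3) $\wp(x,y)=\wp(y,x)$; (4) $\wp(x,y)\le\wp(x,z)+\wp(z,y)-\wp(z,z)$. The pair $(\mathcal{X},\wp)$ is called a partial metric space. A sequence of functions $f_n:\mathcal{D}\to\mathcal{X}$ is uniformly convergent to $f:\mathcal{D}\to\mathcal{X}$ on $\mathcal{D}$ if for each $\epsilon>0$ there exists $k=k(\epsilon)\in\mathbb{N}$ such that for all $n\ge k$ and all $x\in\mathcal{D}$, $|\wp(f_n(x),f(x))-\wp(f(x),f(x))|<\epsilon$ and $|\wp(f_n(x),f_n(x))-\wp(f(x),f(x))|<\epsilon$. The sequence $\{f_n\}$ is uniformly Cauchy on $\mathcal{D}$ if for each $\epsilon>0$ there exists $N=N(\epsilon)\in\mathbb{N}$ such that $\sup_{x\in\mathcal{D}}|\wp(f_m(x),f_n(x))-\wp(f_j(x),f_k(x))|<\epsilon$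 for all $m\ge j\ge N$ and $n\ge k\ge N$ (the supremum being taken in $[0,\infty]$). *)

theory Defs
  imports Complex_Main "HOL-Library.FuncSet" "HOL-Library.Extended_Nonnegative_Real"
begin

locale partial_metric_space =
  fixes X :: "'a set" and p :: "'a \<Rightarrow> 'a \<Rightarrow> real"
  assumes nonempty: "X \<noteq> {}"
    and eq_iff: "\<lbrakk>x \<in> X; y \<in> X\<rbrakk> \<Longrightarrow> x = y \<longleftrightarrow> p x x = p x y \<and> p x y = p y y"
    and self_nonneg: "x \<in> X \<Longrightarrow> 0 \<le> p x x"
    and self_le: "\<lbrakk>x \<in> X; y \<in> X\<rbrakk> \<Longrightarrow> p x x \<le> p x y"
    and sym: "\<lbrakk>x \<in> X; y \<in> X\<rbrakk> \<Longrightarrow> p x y = p y x"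
    and triangle: "\<lbrakk>x \<in> X; y \<in> X; z \<in> X\<rbrakk> \<Longrightarrow> p x y \<le> p x z + p z y - p z z"

definition pm_uniform_limit_on ::
  "('a \<Rightarrow> 'a \<Rightarrow> real) \<Rightarrow> 'd set \<Rightarrow> (nat \<Rightarrow> 'd \<Rightarrow> 'a) \<Rightarrow> ('d \<Rightarrow> 'a) \<Rightarrow> bool" where
  "pm_uniform_limit_on p D f g \<longleftrightarrow>
     (\<forall>\<epsilon>>0. \<exists>k. \<forall>n\<ge>k. \<forall>x\<in>D.
        \<bar>p (f n x) (g x) - p (g x) (g x)\<bar> < \<epsilon> \<and>
        \<bar>p (f n x) (f n x) - p (g x) (g x)\<bar> < \<epsilon>)"

definition pm_uniformly_convergent_on ::
  "'a set \<Rightarrow> ('a \<Rightarrow> 'a \<Rightarrow> real) \<Rightarrow> 'd set \<Rightarrow> (nat \<Rightarrow> 'd \<Rightarrow> 'a) \<Rightarrow> bool" where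
  "pm_uniformly_convergent_on X p D f \<longleftrightarrow> (\<exists>g \<in> D \<rightarrow> X. pm_uniform_limit_on p D f g)"

(* The supremum is taken in [0,\<infinity>], hence the embedding into ennreal: over the reals,
   Sup is unspecified on unbounded sets. *)
definition pm_uniformly_Cauchy_on ::
  "('a \<Rightarrow> 'a \<Rightarrow> real) \<Rightarrow> 'd set \<Rightarrow> (nat \<Rightarrow> 'd \<Rightarrow> 'a) \<Rightarrow> bool" where
  "pm_uniformly_Cauchy_on p D f \<longleftrightarrow>
     (\<forall>\<epsilon>::real. \<epsilon> > 0 \<longrightarrow> (\<exists>N. \<forall>m n j k. m \<ge> j \<and> j \<ge> N \<and> n \<ge> k \<and> k \<ge> N \<longrightarrow>
        (SUP x\<in>D. ennreal \<bar>p (f m x) (f n x) - p (f j x) (f k x)\<bar>) < ennreal \<epsilon>))"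

end

theory Submission
  imports Defs
begin

text \<open>For large \<open>m\<close> and \<open>n\<close>, \<open>p (f m x) (f n x)\<close> is
  close to the self-distance \<open>p (g x) (g x)\<close> of the limit, uniformly in
  \<open>x\<close>. Two such values share this reference number, so they are close to each other.
  The closeness is \<open>dist_near_self_dist\<close>: the triangle inequality through
  \<open>c\<close> bounds \<open>p a b\<close> from above, and the self-distance
  \<open>p a a\<close> bounds it from below.\<close>

lemma (in partial_metric_space) dist_near_self_dist:
  assumes "a \<in> X" "b \<in> X" "c \<in> X"
    and a: "\<bar>p a c - p c c\<bar> < \<delta>" "\<bar>p a a - p c c\<bar> < \<delta>"
    and b: "\<bar>p b c - p c c\<bar> < \<delta>"
  shows "\<bar>p a b - p c c\<bar> < 2 * \<delta>"
proof -
  have "p a b \<le> p a c + p b c - p c c"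
    using triangle[of a b c] sym[of c b] assms(1-3) by simp
  \<comment> \<open>The lower bound is where closeness of \<open>p a a\<close> to
    \<open>p c c\<close> enters: \<open>p a b\<close> cannot fall below
    \<open>p c c - \<delta>\<close>.\<close>
  moreover have "p a a \<le> p a b"
    using self_le assms(1,2) by blast
  ultimately show ?thesis
    using a b by linarith
qed

theorem theorem3p4:
  fixes X :: "'a set" and p :: "'a \<Rightarrow> 'a \<Rightarrow> real"
    and D :: "'d set" and f :: "nat \<Rightarrow> 'd \<Rightarrow> 'a"
  assumes "partial_metric_space X p"
    and "D \<noteq> {}"
    and "\<And>n. f n \<in> D \<rightarrow> X"
    and "pm_uniformly_convergent_on X p D f"
  shows "pm_uniformly_Cauchy_on p D f"
  unfolding pm_uniformly_Cauchy_on_def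
proof (intro allI impI)
  interpret partial_metric_space X p by fact
  fix \<epsilon> :: real
  assume "\<epsilon> > 0"
  obtain g where g: "g \<in> D \<rightarrow> X" and lim: "pm_uniform_limit_on p D f g"
    using assms(4) unfolding pm_uniformly_convergent_on_def by blast
  \<comment> \<open>Doubling in the lemma gives \<open>\<epsilon> / 4\<close>, and comparing two
    distances through \<open>p (g x) (g x)\<close> gives \<open>\<epsilon> / 2\<close>.\<close>
  have "\<epsilon> / 8 > 0"
    using \<open>\<epsilon> > 0\<close> by simp
  with lim obtain N where N: "\<bar>p (f n x) (g x) - p (g x) (g x)\<bar> < \<epsilon> / 8"
      "\<bar>p (f n x) (f n x) - p (g x) (g x)\<bar> < \<epsilon> / 8" if "n \<ge> N" "x \<in> D" for n x
    unfolding pm_uniform_limit_on_def by meson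
  have near: "\<bar>p (f m x) (f n x) - p (g x) (g x)\<bar> < 2 * (\<epsilon> / 8)"
    if "m \<ge> N" "n \<ge> N" "x \<in> D" for m n x
    using that assms(3) g by (intro dist_near_self_dist N) auto
  have "(SUP x\<in>D. ennreal \<bar>p (f m x) (f n x) - p (f j x) (f k x)\<bar>) < ennreal \<epsilon>"
    if "m \<ge> N" "n \<ge> N" "j \<ge> N" "k \<ge> N" for m n j k
  proof -
    have "\<bar>p (f m x) (f n x) - p (f j x) (f k x)\<bar> \<le> \<epsilon> / 2" if "x \<in> D" for x
      using near[of m n x] near[of j k x] that \<open>m \<ge> N\<close> \<open>n \<ge> N\<close> \<open>j \<ge> N\<close> \<open>k \<ge> N\<close>
      by linarith
    \<comment> \<open>A supremum preserves only non-strict bounds; the slack between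
      \<open>\<epsilon> / 2\<close> and \<open>\<epsilon>\<close> restores strictness.\<close>
    then have "(SUP x\<in>D. ennreal \<bar>p (f m x) (f n x) - p (f j x) (f k x)\<bar>) \<le> ennreal (\<epsilon> / 2)"
      by (intro SUP_least ennreal_leI)
    also have "\<dots> < ennreal \<epsilon>"
      using \<open>\<epsilon> > 0\<close> by (simp add: ennreal_less_iff)
    finally show ?thesis .
  qed
  then show "\<exists>N. \<forall>m n j k. m \<ge> j \<and> j \<ge> N \<and> n \<ge> k \<and> k \<ge> N \<longrightarrow>
      (SUP x\<in>D. ennreal \<bar>p (f m x) (f n x) - p (f j x) (f k x)\<bar>) < ennreal \<epsilon>"
    by (meson order_trans)
qed

end
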